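(* Let $X$ be a Banach space. Then $X^{*}$ is uniformly smooth (in the sense defined in the context) if and only if $X^{*}$ satisfies the following property: for all sequences $(x_n)_{n\ge 0}$, $(y_n)_{n\ge 0}$ in $S_X$ and every $a^{*}\in S_{X^{*}}$ such that $\langle x_n,a^{*}\rangle\to 1$ and $\langle y_n,a^{*}\rangle\to 1$ as $n\to+\infty$, one has $\|x_n-y_n\|\to 0$ as $n\to+\infty$.
   Context: Banach spaces may be real or complex. For a Banach space $Y$, $B_Y$ is its closed unit ball, $S_Y$ its unit sphere, $Y^{*}$ its dual, and $\langle y,y^{*}\rangle$ denotes the duality pairing of $y\in Y$ and $y^{*}\in Y^{*}$. Definition (uniformly smooth; this is the paper's own, pointwise, notion): a Banach space $Y$ is uniformly smooth if for every $y\in S_Y$ there exists a unique point $y^{*}\in S_{Y^{*}}$ such that for every $\varepsilon>0$ there exists $\delta>0$ (depending on $y$ and $\varepsilon$) with the property that $\|y^{*}-g\|<\varepsilon$ whenever $g\in B_{Y^{*}}$ and $\langle y,g\rangle>1-\delta$. In the complex case, the inequality $\langle y,g\rangle>1-\delta$ means that $\langle y,g\rangle$ is a real number and is greater than $1-\delta$. In the theorem this definition is applied with $Y=X^{*}$, so that $Y^{*}=X^{**}$. *)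

theory Defs
  imports "HOL-Analysis.Analysis"
begin

section \<open>Complex Banach spaces\<close>

class complex_normed_vector = real_normed_vector +
  fixes scaleC :: "complex \<Rightarrow> 'a \<Rightarrow> 'a"
  assumes scaleC_add_right: "scaleC c (x + y) = scaleC c x + scaleC c y"
    and scaleC_add_left: "scaleC (c + d) x = scaleC c x + scaleC d x"
    and scaleC_scaleC: "scaleC c (scaleC d x) = scaleC (c * d) x"
    and scaleC_of_real: "scaleC (complex_of_real r) x = scaleR r x"
    and norm_scaleC: "norm (scaleC c x) = cmod c * norm x"

class complex_banach = complex_normed_vector + banach

instantiation complex :: complex_banach
begin

definition scaleC_complex :: "complex \<Rightarrow> complex \<Rightarrow> complex" where
  "scaleC_complex c z = c * z"

instance
  by standard (simp_all add: scaleC_complex_def algebra_simps norm_mult scaleR_conv_of_real)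

end


section \<open>The dual of a complex normed space\<close>

text \<open>The continuous dual of a real normed space is the type of bounded linear
  maps into \<^typ>\<open>real\<close>. In the complex case the functionals have to be complex-linear, whereas
  the maps in the library type are only real-linear; the norm is still the operator norm.\<close>

typedef (overloaded) 'a cdual =
  "{f :: 'a::complex_normed_vector \<Rightarrow>\<^sub>L complex.
      \<forall>c x. blinfun_apply f (scaleC c x) = c * blinfun_apply f x}"
  morphisms blinfun_of_cdual Abs_cdual
  by (intro exI[of _ 0]) simp

setup_lifting type_definition_cdual

lift_definition cdual_apply :: "'a::complex_normed_vector cdual \<Rightarrow> 'a \<Rightarrow> complex"
  is blinfun_apply .

instantiation cdual :: (complex_normed_vector) complex_normed_vector
begin

lift_definition norm_cdual :: "'a cdual \<Rightarrow> real" is norm .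

lift_definition zero_cdual :: "'a cdual" is 0
  by simp

lift_definition plus_cdual :: "'a cdual \<Rightarrow> 'a cdual \<Rightarrow> 'a cdual" is "(+)"
  by (simp add: blinfun.add_left algebra_simps)

lift_definition minus_cdual :: "'a cdual \<Rightarrow> 'a cdual \<Rightarrow> 'a cdual" is "(-)"
  by (simp add: blinfun.diff_left algebra_simps)

lift_definition uminus_cdual :: "'a cdual \<Rightarrow> 'a cdual" is uminus
  by (simp add: blinfun.minus_left)

lift_definition scaleR_cdual :: "real \<Rightarrow> 'a cdual \<Rightarrow> 'a cdual" is scaleR
  by (simp add: blinfun.scaleR_left)

lift_definition scaleC_cdual :: "complex \<Rightarrow> 'a cdual \<Rightarrow> 'a cdual"
  is "\<lambda>c f. blinfun_compose (blinfun_mult_right c) f"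
  by (simp add: algebra_simps)

definition dist_cdual :: "'a cdual \<Rightarrow> 'a cdual \<Rightarrow> real"
  where "dist_cdual f g = norm (f - g)"

definition uniformity_cdual :: "('a cdual \<times> 'a cdual) filter"
  where "uniformity_cdual = (INF e\<in>{0 <..}. principal {(f, g). dist f g < e})"

definition open_cdual :: "'a cdual set \<Rightarrow> bool"
  where "open_cdual S = (\<forall>f\<in>S. \<forall>\<^sub>F (f', g) in uniformity. f' = f \<longrightarrow> g \<in> S)"

definition sgn_cdual :: "'a cdual \<Rightarrow> 'a cdual"
  where "sgn_cdual f = scaleR (inverse (norm f)) f"

instance
proof
  fix f g h :: "'a cdual" and r s :: real and c d :: complex
  show "f + g + h = f + (g + h)" by transfer (rule add.assoc)
  show "f + g = g + f" by transfer (rule add.commute)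
  show "0 + f = f" by transfer simp
  show "- f + f = 0" by transfer simp
  show "f - g = f + - g" by transfer simp
  show "r *\<^sub>R (f + g) = r *\<^sub>R f + r *\<^sub>R g" by transfer (rule scaleR_add_right)
  show "(r + s) *\<^sub>R f = r *\<^sub>R f + s *\<^sub>R f" by transfer (rule scaleR_add_left)
  show "r *\<^sub>R s *\<^sub>R f = (r * s) *\<^sub>R f" by transfer simp
  show "1 *\<^sub>R f = f" by transfer simp
  show "dist f g = norm (f - g)" by (rule dist_cdual_def)
  show "sgn f = inverse (norm f) *\<^sub>R f" by (rule sgn_cdual_def)
  show "(uniformity :: ('a cdual \<times> 'a cdual) filter) =
      (INF e\<in>{0 <..}. principal {(f, g). dist f g < e})"
    by (rule uniformity_cdual_def)
  show "open U = (\<forall>x\<in>U. \<forall>\<^sub>F (x', y) in uniformity. x' = x \<longrightarrow> y \<in> U)" for U :: "'a cdual set"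
    by (rule open_cdual_def)
  show "(norm f = 0) = (f = 0)" by transfer simp
  show "norm (f + g) \<le> norm f + norm g" by transfer (rule norm_triangle_ineq)
  show "norm (r *\<^sub>R f) = \<bar>r\<bar> * norm f" by transfer simp
  show "scaleC c (f + g) = scaleC c f + scaleC c g"
    by transfer (rule blinfun_eqI, simp add: blinfun.add_left algebra_simps)
  show "scaleC (c + d) f = scaleC c f + scaleC d f"
    by transfer (rule blinfun_eqI, simp add: blinfun.add_left algebra_simps)
  show "scaleC c (scaleC d f) = scaleC (c * d) f"
    by transfer (rule blinfun_eqI, simp add: algebra_simps)
  show "scaleC (complex_of_real r) f = r *\<^sub>R f"
    by transfer (rule blinfun_eqI, simp add: blinfun.scaleR_left scaleR_conv_of_real)
  show "norm (scaleC c f) = cmod c * norm f"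
  proof transfer
    fix c :: complex and f :: "'a \<Rightarrow>\<^sub>L complex"
    have le: "norm (blinfun_mult_right c o\<^sub>L f) \<le> cmod c * norm f" for c and f :: "'a \<Rightarrow>\<^sub>L complex"
    proof (rule norm_blinfun_bound)
      show "norm (blinfun_apply (blinfun_mult_right c o\<^sub>L f) x) \<le> cmod c * norm f * norm x" for x
        using mult_left_mono[OF norm_blinfun[of f x] norm_ge_zero[of c]]
        by (simp add: norm_mult mult.assoc)
    qed simp
    show "norm (blinfun_mult_right c o\<^sub>L f) = cmod c * norm f"
    proof (cases "c = 0")
      case True
      then show ?thesis using le[of c f] by simp
    next
      case False
      have "f = blinfun_mult_right (inverse c) o\<^sub>L (blinfun_mult_right c o\<^sub>L f)"
        using False by (intro blinfun_eqI) simp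
      then have "norm f \<le> cmod (inverse c) * norm (blinfun_mult_right c o\<^sub>L f)"
        using le by metis
      then have "cmod c * norm f \<le> norm (blinfun_mult_right c o\<^sub>L f)"
        using False by (simp add: norm_divide field_simps)
      with le[of c f] show ?thesis by linarith
    qed
  qed
qed

end

instance cdual :: (complex_normed_vector) complex_banach
proof
  fix X :: "nat \<Rightarrow> 'a cdual"
  assume "Cauchy X"
  have dist_eq: "dist (blinfun_of_cdual f) (blinfun_of_cdual g) = dist f g" for f g :: "'a cdual"
    unfolding dist_norm by transfer simp
  have "Cauchy (\<lambda>n. blinfun_of_cdual (X n))"
    using \<open>Cauchy X\<close> by (simp add: Cauchy_def dist_eq)
  then obtain f where f: "(\<lambda>n. blinfun_of_cdual (X n)) \<longlonglongrightarrow> f"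
    by (auto simp: Cauchy_convergent_iff convergent_def)
  have lim: "(\<lambda>n. blinfun_apply (blinfun_of_cdual (X n)) x) \<longlonglongrightarrow> blinfun_apply f x" for x
    using f by (intro tendsto_intros)
  have "blinfun_apply f (scaleC c x) = c * blinfun_apply f x" for c x
  proof (rule LIMSEQ_unique[OF lim])
    have "blinfun_apply (blinfun_of_cdual g) (scaleC c x) = c * blinfun_apply (blinfun_of_cdual g) x"
      for g :: "'a cdual"
      using blinfun_of_cdual[of g] by blast
    then show "(\<lambda>n. blinfun_apply (blinfun_of_cdual (X n)) (scaleC c x)) \<longlonglongrightarrow> c * blinfun_apply f x"
      using tendsto_mult_left[OF lim, of c x] by presburger
  qed
  then have "blinfun_of_cdual (Abs_cdual f) = f"
    by (simp add: Abs_cdual_inverse)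
  then have "X \<longlonglongrightarrow> Abs_cdual f"
    using f by (metis dist_eq lim_sequentially)
  then show "convergent X"
    by (auto simp: convergent_def)
qed


section \<open>Uniform smoothness\<close>

text \<open>This notion is pointwise: the number \<open>d\<close> may depend on the point \<open>y\<close> of the unit sphere.\<close>

definition uniformly_smooth :: "'y::banach itself \<Rightarrow> bool" where
  "uniformly_smooth (_ :: 'y itself) \<longleftrightarrow>
    (\<forall>y\<in>sphere (0::'y) 1.
      \<exists>!y' :: 'y \<Rightarrow>\<^sub>L real. y' \<in> sphere 0 1 \<and>
        (\<forall>e>0. \<exists>d>0. \<forall>g\<in>cball 0 1. blinfun_apply g y > 1 - d \<longrightarrow> norm (y' - g) < e))"

definition cuniformly_smooth :: "'y::complex_banach itself \<Rightarrow> bool" where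
  "cuniformly_smooth (_ :: 'y itself) \<longleftrightarrow>
    (\<forall>y\<in>sphere (0::'y) 1.
      \<exists>!y' :: 'y cdual. y' \<in> sphere 0 1 \<and>
        (\<forall>e>0. \<exists>d>0. \<forall>g\<in>cball 0 1.
           cdual_apply g y \<in> \<real> \<and> Re (cdual_apply g y) > 1 - d \<longrightarrow> norm (y' - g) < e))"

end

theory Submission
  imports Defs
begin

text \<open>A maximizing sequence for \<open>a\<close> embeds into the unit ball of \<open>X\<^sup>*\<^sup>*\<close>, so smoothness at \<open>a\<close>
  makes it converge there; the canonical embedding is isometric by the Hahn-Banach theorem.
  Conversely, maximizing sequences for \<open>a\<close> converge to a common maximizer \<open>x\<close>, and evaluation
  at \<open>x\<close> is the required point of \<open>X\<^sup>*\<^sup>*\<close>: if \<open>g a\<close> is close to 1, apply \<open>g\<close> to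
  \<open>a + t f\<close> and compare with an almost norming vector of that functional. The complex case reduces
  to the real one by passing to real parts of functionals.\<close>

section \<open>The Hahn-Banach theorem for a single vector, through minimal sublinear
  functionals\<close>

section \<open>Norming functionals\<close>

text \<open>The bound by the norm is built in so that pointwise infima stay finite and a linear
  functional of this kind has norm at most 1. Homogeneity at \<open>t = 0\<close> follows from
  \<open>p 0 = 2 * p 0\<close>.\<close>

definition sublinear :: "('a::real_normed_vector \<Rightarrow> real) \<Rightarrow> bool" where
  "sublinear p \<longleftrightarrow> (\<forall>x y. p (x + y) \<le> p x + p y) \<and> (\<forall>t>0. \<forall>x. p (t *\<^sub>R x) = t * p x)
    \<and> (\<forall>x. p x \<le> norm x)"

lemma sublinearD:
  assumes "sublinear p"
  shows sublinear_add: "p (x + y) \<le> p x + p y"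
    and sublinear_scale: "t \<ge> 0 \<Longrightarrow> p (t *\<^sub>R x) = t * p x"
    and sublinear_le_norm: "p x \<le> norm x"
    and sublinear_ge_norm: "- norm x \<le> p x"
proof -
  show add: "p (x + y) \<le> p x + p y" and le: "p x \<le> norm x" for x y
    using assms by (auto simp: sublinear_def)
  have zero: "p 0 = 0"
  proof -
    have "p (2 *\<^sub>R 0) = 2 * p 0"
      using assms unfolding sublinear_def by (meson zero_less_numeral)
    then show ?thesis by simp
  qed
  show "t \<ge> 0 \<Longrightarrow> p (t *\<^sub>R x) = t * p x"
    using assms zero by (cases "t = 0") (auto simp: sublinear_def)
  show "- norm x \<le> p x"
    using add[of x "- x"] le[of "- x"] zero by simp
qed

text \<open>Making \<open>p\<close> smaller in the direction \<open>- w\<close> without leaving the sublinear functionals; a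
  minimal sublinear functional is therefore odd, hence linear.\<close>

lemma sublinear_shrink:
  assumes p: "sublinear p"
  shows "\<exists>q. sublinear q \<and> q \<le> p \<and> q (- w) \<le> - p w"
proof -
  let ?F = "\<lambda>x t. p (x + t *\<^sub>R w) - t * p w"
  \<comment> \<open>A sublinear \<open>r\<close> below \<open>p\<close> with
    \<open>r (- w) \<le> - p w\<close> satisfies
    \<open>r x \<le> r (x + t *\<^sub>R w) + t * r (- w) \<le> ?F x t\<close>, so this infimum is
    the largest possible candidate.\<close>
  define q where "q x = (INF t\<in>{0..}. ?F x t)" for x
  have lower: "- norm x \<le> ?F x t" if "t \<ge> 0" for x t
    using sublinear_add[OF p, of "x + t *\<^sub>R w" "- x"] sublinear_le_norm[OF p, of "- x"]
      sublinear_scale[OF p that, of w] by simp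
  have bdd: "bdd_below (?F x ` {0..})" for x
    using lower by (intro bdd_belowI[of _ "- norm x"]) auto
  have le: "q x \<le> ?F x t" if "t \<ge> 0" for x t
    unfolding q_def using that by (intro cINF_lower bdd) auto
  have ge: "m \<le> q x" if "\<And>t. t \<ge> 0 \<Longrightarrow> m \<le> ?F x t" for m x
    unfolding q_def using that by (intro cINF_greatest) auto
  have qp: "q x \<le> p x" for x
    using le[of 0 x] by simp
  \<comment> \<open>The parameters add up to \<open>s + t\<close>; subadditivity then follows by
    taking the infimum over \<open>t\<close> first and over \<open>s\<close> afterwards.\<close>
  have sum: "q (x + y) - ?F x s \<le> ?F y t" if "s \<ge> 0" "t \<ge> 0" for x y s t
    using le[of "s + t" "x + y"] that
      sublinear_add[OF p, of "x + s *\<^sub>R w" "y + t *\<^sub>R w"]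
    by (simp add: algebra_simps)
  have add: "q (x + y) \<le> q x + q y" for x y
  proof -
    have "q (x + y) - q y \<le> ?F x s" if "s \<ge> 0" for s
    proof -
      have "q (x + y) - ?F x s \<le> q y" by (intro ge sum that)
      then show ?thesis by linarith
    qed
    then have "q (x + y) - q y \<le> q x" by (rule ge)
    then show ?thesis by simp
  qed
  \<comment> \<open>The substitution of \<open>t / c\<close> for \<open>t\<close> maps the parameter
    range onto itself. The reverse inequality is the same fact for \<open>inverse c\<close>.\<close>
  have scale_le: "c * q x \<le> q (c *\<^sub>R x)" if "c > 0" for c x
  proof (rule ge)
    fix t :: real assume "t \<ge> 0"
    have eq: "c *\<^sub>R x + t *\<^sub>R w = c *\<^sub>R (x + (t / c) *\<^sub>R w)"
      using that by (simp add: algebra_simps)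
    have "p (c *\<^sub>R x + t *\<^sub>R w) = c * p (x + (t / c) *\<^sub>R w)"
      unfolding eq using that by (intro sublinear_scale[OF p]) simp
    then have "?F (c *\<^sub>R x) t = c * ?F x (t / c)"
      using that by (simp add: right_diff_distrib)
    then show "c * q x \<le> ?F (c *\<^sub>R x) t"
      using le[of "t / c" x] that \<open>t \<ge> 0\<close> by simp
  qed
  have scale: "q (c *\<^sub>R x) = c * q x" if "c > 0" for c x
  proof -
    have "inverse c * q (c *\<^sub>R x) \<le> q x"
      using scale_le[of "inverse c" "c *\<^sub>R x"] that by simp
    then have "q (c *\<^sub>R x) \<le> c * q x"
      using that by (simp add: field_simps)
    then show ?thesis using scale_le[OF that, of x] by simp
  qed
  have "sublinear q"
    unfolding sublinear_def using add scale qp sublinear_le_norm[OF p] order_trans by blast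
  \<comment> \<open>At \<open>t = 1\<close> the vector \<open>- w + t *\<^sub>R w\<close> vanishes
    and \<open>p 0 = 0\<close>.\<close>
  moreover have "q (- w) \<le> - p w"
    using le[of 1 "- w"] sublinear_scale[OF p, of 0 0] by simp
  ultimately show ?thesis using qp by (auto simp: le_fun_def)
qed

text \<open>The pointwise infimum works: of two members of a chain the smaller one bounds both terms
  of a sum, so subadditivity survives, and \<open>- norm x\<close> bounds all values at
  \<open>x\<close> from below. This provides the bounds for Zorn's lemma.\<close>

lemma sublinear_Inf_chain:
  assumes ne: "C \<noteq> {}" and sub: "\<And>p. p \<in> C \<Longrightarrow> sublinear p"
    and chain: "\<And>p q. p \<in> C \<Longrightarrow> q \<in> C \<Longrightarrow> p \<le> q \<or> q \<le> p"
  shows "\<exists>u. sublinear u \<and> (\<forall>p\<in>C. u \<le> p)"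
proof -
  define u where "u x = (INF p\<in>C. p x)" for x
  have bdd: "bdd_below ((\<lambda>p. p x) ` C)" for x
    using sublinear_ge_norm sub by (intro bdd_belowI[of _ "- norm x"]) auto
  have le: "u x \<le> p x" if "p \<in> C" for p x
    unfolding u_def using that by (intro cINF_lower bdd) auto
  have ge: "m \<le> u x" if "\<And>p. p \<in> C \<Longrightarrow> m \<le> p x" for m x
    unfolding u_def using that ne by (intro cINF_greatest) auto
  have sum: "u (x + y) \<le> p x + q y" if pq: "p \<in> C" "q \<in> C" for p q x y
  proof -
    obtain r where r: "r \<in> C" "r \<le> p" "r \<le> q"
      using chain[OF pq] pq by (metis order_refl)
    then have "r x \<le> p x" "r y \<le> q y" by (auto simp: le_fun_def)
    then show ?thesis
      using le[OF r(1), of "x + y"] sublinear_add[OF sub[OF r(1)], of x y] by linarith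
  qed
  have "u (x + y) \<le> u x + u y" for x y
  proof -
    have "u (x + y) - u y \<le> p x" if p: "p \<in> C" for p
    proof -
      have "u (x + y) - p x \<le> q y" if "q \<in> C" for q
        using sum[OF p that, of x y] by linarith
      then have "u (x + y) - p x \<le> u y" by (rule ge)
      then show ?thesis by linarith
    qed
    then have "u (x + y) - u y \<le> u x" by (rule ge)
    then show ?thesis by simp
  qed
  moreover have "u (t *\<^sub>R x) = t * u x" if "t > 0" for t x
  proof (rule antisym)
    have "t * u x \<le> p (t *\<^sub>R x)" if "p \<in> C" for p
      using le[OF that, of x] sublinear_scale[OF sub[OF that], of t x] \<open>t > 0\<close> by simp
    then show "t * u x \<le> u (t *\<^sub>R x)" by (rule ge)
    have "u (t *\<^sub>R x) / t \<le> p x" if "p \<in> C" for p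
      using le[OF that, of "t *\<^sub>R x"] sublinear_scale[OF sub[OF that], of t x] \<open>t > 0\<close>
      by (simp add: field_simps)
    then have "u (t *\<^sub>R x) / t \<le> u x" by (rule ge)
    then show "u (t *\<^sub>R x) \<le> t * u x" using that by (simp add: field_simps)
  qed
  moreover have "u x \<le> norm x" for x
  proof -
    obtain p where "p \<in> C" using ne by blast
    then show ?thesis using le[of p x] sublinear_le_norm[OF sub, of p x] by linarith
  qed
  ultimately have "sublinear u"
    by (simp add: sublinear_def)
  then show ?thesis
    using le by (intro exI[of _ u]) (auto simp: le_fun_def)
qed

lemma minimal_sublinear:
  assumes p: "sublinear (p :: 'a::real_normed_vector \<Rightarrow> real)"
  shows "\<exists>m. sublinear m \<and> m \<le> p \<and> (\<forall>q. sublinear q \<longrightarrow> q \<le> m \<longrightarrow> q = m)"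
proof -
  define A where "A = {q. sublinear q \<and> q \<le> p}"
  \<comment> \<open>Zorn's lemma for the reversed order; the empty chain is bounded by
    \<open>p\<close> itself.\<close>
  have "\<exists>m\<in>A. \<forall>q\<in>A. m \<ge> q \<longrightarrow> q = m"
  proof (rule predicate_Zorn)
    show "partial_order_on A (relation_of (\<ge>) A)"
      by (rule partial_order_on_relation_ofI) auto
    fix C assume C: "C \<in> Chains (relation_of (\<ge>) A)"
    then have CA: "C \<subseteq> A" and chain: "\<And>p q. p \<in> C \<Longrightarrow> q \<in> C \<Longrightarrow> p \<le> q \<or> q \<le> p"
      by (auto simp: Chains_def relation_of_def)
    show "\<exists>u\<in>A. \<forall>q\<in>C. q \<ge> u"
    proof (cases "C = {}")
      case True
      then show ?thesis using p by (auto simp: A_def)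
    next
      case False
      then obtain u where u: "sublinear u" "\<forall>q\<in>C. u \<le> q"
        using sublinear_Inf_chain[of C] CA chain by (auto simp: A_def)
      moreover obtain q where "q \<in> C" using False by blast
      then have "u \<le> q" "q \<le> p" using u(2) CA by (auto simp: A_def)
      then have "u \<le> p" by (rule order_trans)
      ultimately show ?thesis by (auto simp: A_def)
    qed
  qed
  then show ?thesis
    by (auto simp: A_def intro: order_trans)
qed

text \<open>Shrinking the norm in the direction \<open>- w\<close> and passing to a minimal
  \<open>m\<close> below the result gives a linear functional with
  \<open>m (- w) \<le> - norm w\<close>. Asking for \<open>norm f \<le> 1\<close> rather than
  equality covers the zero space.\<close>

lemma norming_functional:
  fixes w :: "'a::real_normed_vector"
  shows "\<exists>f :: 'a \<Rightarrow>\<^sub>L real. norm f \<le> 1 \<and> blinfun_apply f w = norm w"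
proof -
  have "sublinear (norm :: 'a \<Rightarrow> real)"
    by (auto simp: sublinear_def norm_triangle_ineq)
  then obtain p :: "'a \<Rightarrow> real" where p: "sublinear p" "p (- w) \<le> - norm w"
    using sublinear_shrink by blast
  obtain m where m: "sublinear m" "m \<le> p" and min: "\<And>q. sublinear q \<Longrightarrow> q \<le> m \<Longrightarrow> q = m"
    using minimal_sublinear[OF p(1)] by blast
  have odd: "m (- x) = - m x" for x
  proof -
    obtain q where "sublinear q" "q \<le> m" "q (- x) \<le> - m x"
      using sublinear_shrink[OF m(1)] by blast
    then have "m (- x) \<le> - m x" using min by blast
    moreover have "m 0 \<le> m x + m (- x)" "m 0 = 0"
      using sublinear_add[OF m(1), of x "- x"] sublinear_scale[OF m(1), of 0 x] by auto
    ultimately show ?thesis by simp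
  qed
  \<comment> \<open>The reverse inequality is subadditivity for \<open>x = (x + y) + (- y)\<close>
    combined with oddness.\<close>
  have add: "m (x + y) = m x + m y" for x y
    using sublinear_add[OF m(1), of x y] sublinear_add[OF m(1), of "x + y" "- y"] odd[of y] by simp
  have scale: "m (t *\<^sub>R x) = t * m x" for t x
    using sublinear_scale[OF m(1), of t x] sublinear_scale[OF m(1), of "- t" x] odd[of "t *\<^sub>R x"]
    by (cases "t \<ge> 0") auto
  have bound: "\<bar>m x\<bar> \<le> norm x" for x
    using sublinear_le_norm[OF m(1), of x] sublinear_ge_norm[OF m(1), of x] by linarith
  have "bounded_linear m"
    using add scale bound by (intro bounded_linear_intro[where K = 1]) auto
  then have m_eq: "blinfun_apply (Blinfun m) = m"
    by (rule bounded_linear_Blinfun_apply)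
  have "norm (Blinfun m) \<le> 1"
    using bound by (intro norm_blinfun_bound) (auto simp: m_eq)
  moreover have "m w = norm w"
    using p(2) m(2) odd[of w] sublinear_le_norm[OF m(1), of w]
    by (auto simp: le_fun_def dest: spec[of _ "- w"])
  ultimately show ?thesis using m_eq by metis
qed

section \<open>Abstract dual pairings and the behaviour of maximizing sequences\<close>

section \<open>Pairings\<close>

text \<open>Only real linearity is required, so real parts of complex pairings are instances too.
  \<open>almost_attained\<close> says that the norm of \<open>f\<close> is a supremum over the unit
  sphere; \<open>0 \<le> r\<close> forces \<open>f\<close> to be nonzero, so that the sphere is
  nonempty.\<close>

locale norming_pairing =
  fixes b :: "'d::real_normed_vector \<Rightarrow> 'x::real_normed_vector \<Rightarrow> real"
  assumes add_left: "b (f + g) x = b f x + b g x"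
    and scaleR_left: "b (t *\<^sub>R f) x = t * b f x"
    and add_right: "b f (x + y) = b f x + b f y"
    and scaleR_right: "b f (t *\<^sub>R x) = t * b f x"
    and le_norm: "b f x \<le> norm f * norm x"
    and almost_attained: "0 \<le> r \<Longrightarrow> r < norm f \<Longrightarrow> \<exists>x. norm x = 1 \<and> r < b f x"
begin

lemma minus_right: "b f (- x) = - b f x"
  using scaleR_right[of f "-1" x] by simp

lemma minus_left: "b (- f) x = - b f x"
  using scaleR_left[of "-1" f x] by simp

lemma diff_right: "b f (x - y) = b f x - b f y"
  using add_right[of f x "- y"] minus_right[of f y] by simp

lemma diff_left: "b (f - g) x = b f x - b g x"
  using add_left[of f "- g" x] minus_left[of g x] by simp

lemma norm_le: "0 \<le> r \<Longrightarrow> (\<And>x. norm x = 1 \<Longrightarrow> b f x \<le> r) \<Longrightarrow> norm f \<le> r"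
  using almost_attained[of r f] by force

definition smooth_point :: "'x \<Rightarrow> 'd \<Rightarrow> bool" where
  "smooth_point x f \<longleftrightarrow> (\<forall>e>0. \<exists>d>0. \<forall>g\<in>cball 0 1. b g x > 1 - d \<longrightarrow> norm (f - g) < e)"

definition maximizing_limits :: "'d \<Rightarrow> bool" where
  "maximizing_limits a \<longleftrightarrow> (\<forall>x y. (\<forall>n. x n \<in> sphere 0 1) \<longrightarrow> (\<forall>n. y n \<in> sphere 0 1) \<longrightarrow>
    (\<lambda>n::nat. b a (x n)) \<longlonglongrightarrow> 1 \<longrightarrow> (\<lambda>n. b a (y n)) \<longlonglongrightarrow> 1 \<longrightarrow> (\<lambda>n. norm (x n - y n)) \<longlonglongrightarrow> 0)"

text \<open>The slices of the sphere cut off by \<open>a\<close> have small diameter: otherwise the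
  widths \<open>1 / (n + 1)\<close> yield two maximizing sequences that stay at distance at least
  \<open>e\<close>.\<close>

lemma maximizing_limits_uniform:
  assumes a: "norm a = 1" and lim: "maximizing_limits a" and "e > 0"
  shows "\<exists>d>0. \<forall>x y. norm x = 1 \<longrightarrow> norm y = 1 \<longrightarrow> b a x > 1 - d \<longrightarrow> b a y > 1 - d \<longrightarrow>
    norm (x - y) < e"
proof (rule ccontr)
  assume contra: "\<not> ?thesis"
  have "\<exists>x y. norm x = 1 \<and> norm y = 1 \<and> b a x > 1 - inverse (real (Suc n)) \<and>
      b a y > 1 - inverse (real (Suc n)) \<and> \<not> norm (x - y) < e" for n
    using contra by (metis inverse_positive_iff_positive of_nat_0_less_iff zero_less_Suc)
  then obtain x y where xy: "\<And>n. norm (x n) = 1" "\<And>n. norm (y n) = 1"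
      "\<And>n. b a (x n) > 1 - inverse (real (Suc n))" "\<And>n. b a (y n) > 1 - inverse (real (Suc n))"
      "\<And>n. \<not> norm (x n - y n) < e"
    by metis
  have "(\<lambda>n. 1 - inverse (real (Suc n))) \<longlonglongrightarrow> 1 - 0"
    by (intro tendsto_intros LIMSEQ_inverse_real_of_nat)
  then have inv: "(\<lambda>n. 1 - inverse (real (Suc n))) \<longlonglongrightarrow> 1" by simp
  have to1: "(\<lambda>n. b a (z n)) \<longlonglongrightarrow> 1"
    if z: "\<And>n. norm (z n) = 1" "\<And>n. b a (z n) > 1 - inverse (real (Suc n))" for z
  proof (rule tendsto_sandwich[OF _ _ inv tendsto_const])
    show "\<forall>\<^sub>F n in sequentially. 1 - inverse (real (Suc n)) \<le> b a (z n)"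
      using z(2) by (intro always_eventually allI less_imp_le)
    have "b a (z n) \<le> 1" for n
      using le_norm[of a "z n"] z(1)[of n] a by simp
    then show "\<forall>\<^sub>F n in sequentially. b a (z n) \<le> 1"
      by (intro always_eventually allI)
  qed
  have "(\<lambda>n. norm (x n - y n)) \<longlonglongrightarrow> 0"
    using lim to1[OF xy(1,3)] to1[OF xy(2,4)] xy(1,2) by (simp add: maximizing_limits_def)
  then have "\<forall>\<^sub>F n in sequentially. norm (x n - y n) < e"
    using \<open>e > 0\<close> by (rule order_tendstoD(2))
  then show False using xy(5) by (simp add: eventually_sequentially)
qed

text \<open>A maximizing sequence is Cauchy because its tails lie in slices of small diameter, and
  its limit attains the value 1. Completeness is an explicit hypothesis since the locale only knows
  a normed space.\<close>

lemma maximizer_exists: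
  assumes complete: "\<And>X :: nat \<Rightarrow> 'x. Cauchy X \<Longrightarrow> convergent X"
    and a: "norm a = 1" and lim: "maximizing_limits a"
  shows "\<exists>x. norm x = 1 \<and> b a x = 1"
proof -
  \<comment> \<open>For \<open>n = 0\<close> the threshold is exactly 0, which
    \<open>almost_attained\<close> still admits.\<close>
  have "\<exists>x. norm x = 1 \<and> 1 - inverse (real (Suc n)) < b a x" for n
    using almost_attained[of "1 - inverse (real (Suc n))" a] a by (simp add: field_simps)
  then obtain x where x: "\<And>n. norm (x n) = 1" "\<And>n. 1 - inverse (real (Suc n)) < b a (x n)"
    by metis
  have "(\<lambda>n. 1 - inverse (real (Suc n))) \<longlonglongrightarrow> 1 - 0"
    by (intro tendsto_intros LIMSEQ_inverse_real_of_nat)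
  then have lb: "\<forall>\<^sub>F n in sequentially. r < b a (x n)" if "r < 1" for r
  proof -
    have "\<forall>\<^sub>F n in sequentially. r < 1 - inverse (real (Suc n))"
      using order_tendstoD(1)[OF \<open>_ \<longlonglongrightarrow> 1 - 0\<close>] that by simp
    then show ?thesis
      by (rule eventually_mono) (use x(2) less_trans in blast)
  qed
  have "Cauchy x"
  proof (rule CauchyI)
    fix e :: real assume "e > 0"
    then obtain d where d: "d > 0" "\<forall>x y. norm x = 1 \<longrightarrow> norm y = 1 \<longrightarrow> b a x > 1 - d \<longrightarrow>
        b a y > 1 - d \<longrightarrow> norm (x - y) < e"
      using maximizing_limits_uniform[OF a lim] by blast
    obtain N where "\<forall>n\<ge>N. 1 - d < b a (x n)"
      using lb[of "1 - d"] d(1) by (auto simp: eventually_sequentially)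
    then show "\<exists>M. \<forall>m\<ge>M. \<forall>n\<ge>M. norm (x m - x n) < e"
      using d(2) x(1) by (intro exI[of _ N]) simp
  qed
  then obtain l where l: "x \<longlonglongrightarrow> l"
    using complete by (auto simp: convergent_def)
  have "norm l = 1"
    using tendsto_norm[OF l] x(1) by (simp add: LIMSEQ_const_iff)
  moreover have "b a l \<ge> 1"
  proof (rule field_le_epsilon)
    fix e :: real assume "e > 0"
    then have "\<forall>\<^sub>F n in sequentially. dist (x n) l < e / 2 \<and> 1 - e / 2 < b a (x n)"
      using tendstoD[OF l, of "e / 2"] lb[of "1 - e / 2"] by (intro eventually_conj) auto
    then obtain n where n: "norm (x n - l) < e / 2" "1 - e / 2 < b a (x n)"
      by (auto simp: eventually_sequentially dist_norm)
    then show "1 \<le> b a l + e"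
      using le_norm[of a "x n - l"] a by (simp add: diff_right)
  qed
  ultimately show ?thesis using le_norm[of a l] a by force
qed

end

section \<open>The canonical embedding into the bidual and smooth points of the dual\<close>

locale bidual_pairing = B: norming_pairing b + C: norming_pairing c
  for b :: "'d::real_normed_vector \<Rightarrow> 'x::banach \<Rightarrow> real"
    and c :: "'e::real_normed_vector \<Rightarrow> 'd \<Rightarrow> real" +
  fixes J :: "'x \<Rightarrow> 'e"
  assumes norming: "\<exists>f. norm f \<le> 1 \<and> b f x = norm x"
    and embed: "c (J x) f = b f x"
begin

lemma norm_embed_le: "norm (J x) \<le> norm x"
proof (rule C.norm_le)
  show "c (J x) f \<le> norm x" if "norm f = 1" for f
    using B.le_norm[of f x] that by (simp add: embed)
qed simp

text \<open>\<open>J x - J y\<close> is tested on a functional that norms \<open>x - y\<close>. The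
  form with differences suits a \<open>J\<close> that is described only through its pairing.\<close>

lemma norm_diff_le: "norm (x - y) \<le> norm (J x - J y)"
proof -
  obtain f where f: "norm f \<le> 1" "b f (x - y) = norm (x - y)" using norming by blast
  then have "norm (x - y) = c (J x - J y) f"
    by (simp add: C.diff_left embed B.diff_right)
  also have "\<dots> \<le> norm (J x - J y) * norm f" by (rule C.le_norm)
  also have "\<dots> \<le> norm (J x - J y)" using f(1) by (simp add: mult_left_le)
  finally show ?thesis .
qed

text \<open>\<open>J z\<close> lies in the unit ball and takes the value \<open>b a z\<close> at
  \<open>a\<close>, so along both sequences it is eventually within \<open>e / 2\<close> of
  \<open>F\<close>; \<open>norm_diff_le\<close> brings the estimate back to the original
  space.\<close>

lemma smooth_point_imp_maximizing_limits:
  assumes "C.smooth_point a F"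
  shows "B.maximizing_limits a"
  unfolding B.maximizing_limits_def
proof (intro allI impI)
  fix x y :: "nat \<Rightarrow> 'x"
  assume x: "\<forall>n. x n \<in> sphere 0 1" "(\<lambda>n. b a (x n)) \<longlonglongrightarrow> 1"
    and y: "\<forall>n. y n \<in> sphere 0 1" "(\<lambda>n. b a (y n)) \<longlonglongrightarrow> 1"
  show "(\<lambda>n. norm (x n - y n)) \<longlonglongrightarrow> 0"
  proof (rule tendstoI)
    fix e :: real assume "e > 0"
    then obtain d where d: "d > 0" "\<And>g. g \<in> cball 0 1 \<Longrightarrow> c g a > 1 - d \<Longrightarrow> norm (F - g) < e / 2"
      using assms unfolding C.smooth_point_def by (meson half_gt_zero)
    have near: "norm (F - J z) < e / 2" if "norm z = 1" "1 - d < b a z" for z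
      using d(2)[of "J z"] norm_embed_le[of z] that by (simp add: embed)
    have "\<forall>\<^sub>F n in sequentially. 1 - d < b a (x n)" "\<forall>\<^sub>F n in sequentially. 1 - d < b a (y n)"
      using d(1) order_tendstoD(1)[OF x(2)] order_tendstoD(1)[OF y(2)] by auto
    then show "\<forall>\<^sub>F n in sequentially. dist (norm (x n - y n)) 0 < e"
    proof eventually_elim
      case (elim n)
      then have "norm (F - J (x n)) < e / 2" "norm (F - J (y n)) < e / 2"
        using x(1) y(1) near[of "x n"] near[of "y n"] by auto
      then have "norm (J (x n) - J (y n)) < e"
        using norm_triangle_ineq4[of "F - J (y n)" "F - J (x n)"] by (simp add: algebra_simps)
      then show ?case using norm_diff_le[of "x n" "y n"] by simp
    qed
  qed
qed

text \<open>Evaluating \<open>g\<close> at \<open>a + t f\<close> and testing the norm of \<open>a + t f\<close> on a nearly norming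
  \<open>z\<close> forces \<open>z\<close> close to the maximizer of \<open>a\<close>, and then compares \<open>g f\<close> with \<open>f z\<close>; this
  replaces Goldstine's theorem.\<close>

lemma maximizing_limits_imp_smooth_point:
  assumes a: "norm a = 1" and lim: "B.maximizing_limits a"
    and x: "norm x = 1" "b a x = 1"
  shows "C.smooth_point a (J x)"
  unfolding C.smooth_point_def
proof (intro allI impI)
  fix e :: real assume "e > 0"
  then obtain d0 where d0: "d0 > 0" "\<And>z. norm z = 1 \<Longrightarrow> b a z > 1 - d0 \<Longrightarrow> norm (z - x) < e / 4"
    using B.maximizing_limits_uniform[OF a lim, of "e / 4"] x by auto
  \<comment> \<open>Later \<open>b a z > 1 - 2 * t - 2 * k\<close> has to exceed
    \<open>1 - d0\<close>, and \<open>2 * t + 2 * k \<le> 3 * s / 4\<close>. The cap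
    \<open>s \<le> 1\<close> keeps \<open>?r\<close> nonnegative, and
    \<open>k \<le> t * e / 4\<close> keeps the error \<open>2 * k\<close> below
    \<open>t * e / 2\<close>.\<close>
  define s where "s = min d0 1"
  have s: "0 < s" "s \<le> 1" "s \<le> d0" using d0 by (auto simp: s_def)
  define t where "t = s / 4"
  define k where "k = min (t * e / 4) (s / 8)"
  have t: "t > 0" using s by (simp add: t_def)
  have k: "0 < k" "k \<le> t * e / 4" "k \<le> s / 8" using s t \<open>e > 0\<close> by (auto simp: k_def)
  have "norm (J x - g) < e" if g: "g \<in> cball 0 1" "1 - k < c g a" for g
  proof -
    \<comment> \<open>The target is \<open>3 * e / 4\<close> because a supremum only gives a weak
      inequality.\<close>
    have "norm (g - J x) \<le> 3 * e / 4"
    proof (rule C.norm_le)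
      fix f :: 'd assume f: "norm f = 1"
      have small: "b f z \<le> norm z" "- norm z \<le> b f z" for z
        using B.le_norm[of f z] B.le_norm[of f "- z"] f by (auto simp: B.minus_right)
      have gle: "c g h \<le> norm h" for h
        using C.le_norm[of g h] g(1) mult_right_mono[of "norm g" 1 "norm h"] by simp
      have cf: "- 1 \<le> c g f"
        using gle[of "- f"] f by (simp add: C.minus_right)
      have tf: "- t \<le> t * c g f"
        using mult_left_mono[OF cf, of t] t by simp
      let ?r = "c g a + t * c g f - k"
      have "?r < norm (a + t *\<^sub>R f)"
        using gle[of "a + t *\<^sub>R f"] k(1) by (simp add: C.add_right C.scaleR_right)
      moreover have "0 \<le> ?r"
        using g(2) tf k s by (simp add: t_def)
      ultimately obtain z where z: "norm z = 1" "?r < b a z + t * b f z"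
        using B.almost_attained[of ?r "a + t *\<^sub>R f"] by (auto simp: B.add_left B.scaleR_left)
      have "t * b f z \<le> t"
        using small(1)[of z] z(1) t by simp
      \<comment> \<open>Here \<open>b f z \<le> 1\<close> and \<open>c g f \<ge> - 1\<close> cost
        \<open>t\<close> each, while \<open>c g a > 1 - k\<close> and the slack in \<open>?r\<close>
        cost \<open>k\<close> each.\<close>
      then have "b a z > 1 - d0"
        using z(2) g(2) tf k s t_def by linarith
      then have "b f z - b f x < e / 4"
        using d0(2)[OF z(1)] small(1)[of "z - x"] by (simp add: B.diff_right)
      then have "t * b f z - t * b f x \<le> t * e / 4"
        using mult_left_mono[of "b f z - b f x" "e / 4" t] t by (simp add: algebra_simps)
      moreover have "b a z \<le> 1" using B.le_norm[of a z] a z(1) by simp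
      \<comment> \<open>\<open>b a z - c g a + k\<close> is less than \<open>2 * k\<close>, hence
        less than \<open>t * e / 2\<close>; the slice estimate adds
        \<open>t * e / 4\<close>.\<close>
      ultimately have "t * (c g f - b f x) < t * (3 * e / 4)"
        using z(2) g(2) k by (simp add: algebra_simps)
      then have "c g f - b f x < 3 * e / 4" using t by simp
      then show "c (g - J x) f \<le> 3 * e / 4" by (simp add: C.diff_left embed)
    qed (use \<open>e > 0\<close> in simp)
    then show ?thesis using \<open>e > 0\<close> by (simp add: norm_minus_commute)
  qed
  then show "\<exists>d>0. \<forall>g\<in>cball 0 1. c g a > 1 - d \<longrightarrow> norm (J x - g) < e"
    using k(1) by blast
qed

text \<open>The point is \<open>J x\<close> for a maximizer \<open>x\<close> of \<open>a\<close>. It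
  is unique because \<open>J x\<close> has value 1 at \<open>a\<close> and so passes the test for
  every \<open>d\<close>, which puts any smooth point \<open>F\<close> within every \<open>e\<close>
  of it.\<close>

lemma ex1_smooth_point_iff:
  assumes a: "norm a = 1"
  shows "(\<exists>!F. norm F = 1 \<and> C.smooth_point a F) \<longleftrightarrow> B.maximizing_limits a"
proof
  assume lim: "B.maximizing_limits a"
  obtain x where x: "norm x = 1" "b a x = 1"
    using B.maximizer_exists[OF _ a lim] Cauchy_convergent by blast
  have J: "C.smooth_point a (J x)"
    by (rule maximizing_limits_imp_smooth_point[OF a lim x])
  have le: "norm (J x) \<le> 1" using norm_embed_le[of x] x by simp
  have "norm (J x) \<ge> 1" using C.le_norm[of "J x" a] x a by (simp add: embed)
  with le have "norm (J x) = 1" by simp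
  moreover have "F = J x" if F: "C.smooth_point a F" for F
  proof (rule ccontr)
    assume "F \<noteq> J x"
    then have "norm (F - J x) > 0" by simp
    with F obtain d where "d > 0" "\<forall>g\<in>cball 0 1. c g a > 1 - d \<longrightarrow> norm (F - g) < norm (F - J x)"
      unfolding C.smooth_point_def by metis
    moreover have "J x \<in> cball 0 1" using le by simp
    ultimately have "norm (F - J x) < norm (F - J x)"
      using x(2) embed[of x a] by (metis diff_less_eq less_add_same_cancel1)
    then show False by simp
  qed
  ultimately show "\<exists>!F. norm F = 1 \<and> C.smooth_point a F"
    using J by (intro ex1I[of _ "J x"] conjI) (assumption | elim conjE)+
next
  assume "\<exists>!F. norm F = 1 \<and> C.smooth_point a F"
  then show "B.maximizing_limits a"
    by (elim ex1E conjE) (rule smooth_point_imp_maximizing_limits)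
qed

end

section \<open>The concrete pairings for real and complex scalars\<close>

section \<open>Real and complex duals\<close>

text \<open>A bound \<open>r\<close> for \<open>f\<close> on the unit sphere holds at
  \<open>sgn x\<close> and at \<open>- sgn x\<close>, hence bounds the absolute value and the
  operator norm.\<close>

lemma norming_pairing_blinfun:
  "norming_pairing (blinfun_apply :: ('a::real_normed_vector \<Rightarrow>\<^sub>L real) \<Rightarrow> 'a \<Rightarrow> real)"
proof
  fix f :: "'a \<Rightarrow>\<^sub>L real" and x :: 'a
  show "blinfun_apply f x \<le> norm f * norm x"
    using norm_blinfun[of f x] by simp
next
  fix f :: "'a \<Rightarrow>\<^sub>L real" and r :: real
  assume r: "0 \<le> r" "r < norm f"
  show "\<exists>x. norm x = 1 \<and> r < blinfun_apply f x"
  proof (rule ccontr)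
    assume "\<not> ?thesis"
    then have le: "blinfun_apply f x \<le> r" if "norm x = 1" for x
      using that not_less by blast
    have "norm (blinfun_apply f x) \<le> r * norm x" for x
    proof (cases "x = 0")
      case False
      then have "norm (sgn x) = 1" "norm (- sgn x) = 1" by (simp_all add: norm_sgn)
      then have "\<bar>blinfun_apply f (sgn x)\<bar> \<le> r"
        using le[of "sgn x"] le[of "- sgn x"] by (simp add: blinfun.minus_right)
      then show ?thesis
        using False by (simp add: sgn_div_norm blinfun.scaleR_right abs_mult field_simps)
    qed simp
    then show False
      using norm_blinfun_bound[of r f] r by force
  qed
qed (simp_all add: blinfun.add_left blinfun.add_right blinfun.scaleR_left blinfun.scaleR_right)

lemma blinfun_evaluation:
  "\<exists>F :: ('a::real_normed_vector \<Rightarrow>\<^sub>L real) \<Rightarrow>\<^sub>L real. \<forall>f. blinfun_apply F f = blinfun_apply f x"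
  by (metis bounded_linear_Blinfun_apply blinfun.bounded_linear_left)

section \<open>Complex functionals and their real parts\<close>

lemma cdual_apply_add: "cdual_apply (f + g) x = cdual_apply f x + cdual_apply g x"
  by transfer (rule blinfun.add_left)

lemma cdual_apply_scaleR: "cdual_apply (r *\<^sub>R f) x = r *\<^sub>R cdual_apply f x"
  by transfer (rule blinfun.scaleR_left)

lemma cdual_apply_scaleC_left: "cdual_apply (scaleC c f) x = c * cdual_apply f x"
  by transfer simp

lemma cdual_apply_add_right: "cdual_apply f (x + y) = cdual_apply f x + cdual_apply f y"
  by transfer (rule blinfun.add_right)

lemma cdual_apply_scaleR_right: "cdual_apply f (r *\<^sub>R x) = r *\<^sub>R cdual_apply f x"
  by transfer (rule blinfun.scaleR_right)

lemma cdual_apply_scaleC_right: "cdual_apply f (scaleC c x) = c * cdual_apply f x"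
  by transfer blast

lemma norm_cdual_apply: "cmod (cdual_apply f x) \<le> norm f * norm x"
  by transfer (rule norm_blinfun)

lemma norm_cdual_bound:
  "0 \<le> r \<Longrightarrow> (\<And>x. cmod (cdual_apply f x) \<le> r * norm x) \<Longrightarrow> norm f \<le> r"
  by transfer (rule norm_blinfun_bound)

lemma cdual_exists:
  assumes "bounded_linear F" "\<And>c x. F (scaleC c x) = c * F x"
  shows "\<exists>f. \<forall>x. cdual_apply f x = F x"
proof -
  have "cdual_apply (Abs_cdual (Blinfun F)) x = F x" for x
    using assms by (simp add: cdual_apply.rep_eq Abs_cdual_inverse bounded_linear_Blinfun_apply)
  then show ?thesis by blast
qed

text \<open>The conjugate phase of \<open>z\<close>. It lets a modulus be read as a real part after
  the argument of a functional, or the functional itself, is rotated.\<close>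

lemma rotate_to_norm: "\<exists>u. cmod u = 1 \<and> u * z = complex_of_real (cmod z)"
proof (cases "z = 0")
  case False
  have "cnj (sgn z) * z = complex_of_real (cmod z)"
    using False complex_norm_square[of z]
    by (simp add: sgn_div_norm scaleR_conv_of_real field_simps power2_eq_square)
  then show ?thesis using False by (intro exI[of _ "cnj (sgn z)"]) (simp add: norm_sgn)
qed (auto intro: exI[of _ 1])

text \<open>Expanding the square shows that in the unit disc a real part near 1 forces the number
  itself to be near 1; this makes the passage to real parts harmless.\<close>

lemma cmod_diff_1_le:
  assumes "cmod z \<le> 1"
  shows "(cmod (z - 1))\<^sup>2 \<le> 2 * (1 - Re z)"
proof -
  have "(cmod (z - 1))\<^sup>2 = (cmod z)\<^sup>2 + 1 - 2 * Re z"
    unfolding cmod_power2 by (simp add: power2_eq_square algebra_simps)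
  moreover have "(cmod z)\<^sup>2 \<le> 1" using assms by (simp add: power_le_one)
  ultimately show ?thesis by simp
qed

text \<open>Rotating the vector turns the real part of \<open>f x\<close> into its modulus, so both
  have the same supremum over the unit sphere.\<close>

lemma norming_pairing_cdual:
  "norming_pairing (\<lambda>(f :: 'a::complex_normed_vector cdual) x. Re (cdual_apply f x))"
proof
  fix f :: "'a cdual" and x :: 'a
  show "Re (cdual_apply f x) \<le> norm f * norm x"
    using norm_cdual_apply[of f x] complex_Re_le_cmod order_trans by blast
next
  fix f :: "'a cdual" and r :: real
  assume r: "0 \<le> r" "r < norm f"
  show "\<exists>x. norm x = 1 \<and> r < Re (cdual_apply f x)"
  proof (rule ccontr)
    assume "\<not> ?thesis"
    then have le: "Re (cdual_apply f x) \<le> r" if "norm x = 1" for x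
      using that not_less by blast
    have "cmod (cdual_apply f x) \<le> r * norm x" for x
    proof (cases "x = 0")
      case True
      then show ?thesis using norm_cdual_apply[of f 0] by simp
    next
      case False
      obtain u where u: "cmod u = 1" "u * cdual_apply f x = complex_of_real (cmod (cdual_apply f x))"
        using rotate_to_norm by blast
      have "norm (scaleC u (sgn x)) = 1"
        using False u(1) by (simp add: norm_scaleC norm_sgn)
      then have "Re (u * cdual_apply f (sgn x)) \<le> r"
        using le by (metis cdual_apply_scaleC_right)
      moreover have "u * cdual_apply f (sgn x) = cmod (cdual_apply f x) / norm x"
        unfolding sgn_div_norm cdual_apply_scaleR_right
        by (simp add: u(2) scaleR_conv_of_real divide_inverse)
      ultimately show ?thesis using False by (simp add: field_simps)
    qed
    then show False
      using norm_cdual_bound[of r f] r by force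
  qed
qed (simp_all add: cdual_apply_add cdual_apply_add_right cdual_apply_scaleR cdual_apply_scaleR_right)

lemma cdual_evaluation:
  "\<exists>F :: 'a::complex_normed_vector cdual cdual. \<forall>f. cdual_apply F f = cdual_apply f x"
proof (rule cdual_exists)
  show "bounded_linear (\<lambda>f. cdual_apply f x)"
    using norm_cdual_apply[of _ x]
    by (intro bounded_linear_intro[where K = "norm x"]) (simp_all add: cdual_apply_add cdual_apply_scaleR)
qed (simp add: cdual_apply_scaleC_left)

text \<open>A complex functional is recovered from its real part \<open>h\<close> as
  \<open>h x - \<i> * h (\<i> x)\<close>, and a rotation of \<open>x\<close> shows that its norm
  does not exceed the bound for \<open>h\<close>.\<close>

lemma norming_cdual:
  fixes w :: "'a::complex_normed_vector"
  shows "\<exists>f :: 'a cdual. norm f \<le> 1 \<and> Re (cdual_apply f w) = norm w"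
proof -
  obtain h :: "'a \<Rightarrow>\<^sub>L real" where h: "norm h \<le> 1" "blinfun_apply h w = norm w"
    using norming_functional by blast
  define F where "F x = Complex (blinfun_apply h x) (- blinfun_apply h (scaleC \<i> x))" for x
  have h_le: "blinfun_apply h x \<le> norm x" for x
    using norm_blinfun[of h x] mult_right_mono[OF h(1), of "norm x"] by simp
  have add: "F (x + y) = F x + F y" for x y
    by (simp add: F_def complex_eq_iff blinfun.add_right scaleC_add_right)
  have scaleR: "F (r *\<^sub>R x) = r *\<^sub>R F x" for r x
  proof -
    have "scaleC \<i> (r *\<^sub>R x) = r *\<^sub>R scaleC \<i> x"
      by (metis mult.commute scaleC_of_real scaleC_scaleC)
    then show ?thesis
      by (simp add: F_def complex_eq_iff blinfun.scaleR_right)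
  qed
  have scale_i: "F (scaleC \<i> x) = \<i> * F x" for x
  proof -
    have "scaleC \<i> (scaleC \<i> x) = - x"
      using scaleC_of_real[of "-1" x] by (simp add: scaleC_scaleC)
    then show ?thesis by (simp add: F_def complex_eq_iff blinfun.minus_right)
  qed
  have scaleC: "F (scaleC c x) = c * F x" for c x
  proof -
    have "scaleC c x = Re c *\<^sub>R x + Im c *\<^sub>R scaleC \<i> x"
      by (metis complex_eq mult.commute scaleC_add_left scaleC_of_real scaleC_scaleC)
    then have "F (scaleC c x) = (of_real (Re c) + of_real (Im c) * \<i>) * F x"
      by (simp add: add scaleR scale_i scaleR_conv_of_real algebra_simps)
    then show ?thesis by (metis complex_eq mult.commute)
  qed
  have norm_le: "cmod (F x) \<le> norm x" for x
  proof -
    obtain u where u: "cmod u = 1" "u * F x = complex_of_real (cmod (F x))"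
      using rotate_to_norm by blast
    have "cmod (F x) = Re (F (scaleC u x))" by (simp add: scaleC u(2))
    also have "\<dots> \<le> norm (scaleC u x)" using h_le by (simp add: F_def)
    finally show ?thesis by (simp add: norm_scaleC u(1))
  qed
  have "bounded_linear F"
    using add scaleR norm_le by (intro bounded_linear_intro[where K = 1]) auto
  then obtain f where f: "\<And>x. cdual_apply f x = F x"
    using cdual_exists[of F] scaleC by blast
  have "norm f \<le> 1" using norm_le by (intro norm_cdual_bound) (auto simp: f)
  then show ?thesis using f h(2) by (auto simp: F_def)
qed

text \<open>The left side tests only those \<open>g\<close> whose value at \<open>y\<close> is real,
  hence fewer. Conversely, a \<open>g\<close> with real part near 1 at \<open>y\<close> becomes
  admissible after multiplication by a unimodular \<open>u\<close>, which is close to 1.\<close>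

lemma cdual_smooth_point_iff:
  fixes y :: "'y::complex_normed_vector" and F :: "'y cdual"
  assumes y: "norm y = 1"
  shows "(\<forall>e>0. \<exists>d>0. \<forall>g\<in>cball 0 1. cdual_apply g y \<in> \<real> \<and> Re (cdual_apply g y) > 1 - d \<longrightarrow>
      norm (F - g) < e) \<longleftrightarrow>
    norming_pairing.smooth_point (\<lambda>f x. Re (cdual_apply f x)) y F" (is "?L \<longleftrightarrow> ?R")
proof
  assume ?R
  then show ?L
    unfolding norming_pairing.smooth_point_def[OF norming_pairing_cdual] by meson
next
  assume L: ?L
  show ?R
    unfolding norming_pairing.smooth_point_def[OF norming_pairing_cdual]
  proof (intro allI impI)
    fix e :: real assume "e > 0"
    then obtain d where d: "d > 0" "\<And>g. g \<in> cball 0 1 \<Longrightarrow> cdual_apply g y \<in> \<real> \<Longrightarrow>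
        Re (cdual_apply g y) > 1 - d \<Longrightarrow> norm (F - g) < e / 2"
      using L by (meson half_gt_zero)
    \<comment> \<open>\<open>k \<le> d\<close> admits the rotated functional,
      \<open>k \<le> 1\<close> makes \<open>Re z\<close> positive, and
      \<open>k \<le> e\<^sup>2 / 8\<close> turns \<open>2 * k\<close> into at most
      \<open>(e / 2)\<^sup>2\<close>.\<close>
    define k where "k = Min {d, 1, e\<^sup>2 / 8}"
    have k: "0 < k" "k \<le> d" "k \<le> 1" "k \<le> e\<^sup>2 / 8"
      using \<open>e > 0\<close> d(1) by (auto simp: k_def)
    have "norm (F - g) < e" if g: "g \<in> cball 0 1" "1 - k < Re (cdual_apply g y)" for g
    proof -
      define z where "z = cdual_apply g y"
      have Re: "1 - k < Re z" using g(2) by (simp add: z_def)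
      obtain u where u: "cmod u = 1" "u * z = complex_of_real (cmod z)"
        using rotate_to_norm by blast
      have "norm (scaleC u g) \<le> 1" using g(1) u(1) by (simp add: norm_scaleC)
      moreover have "cdual_apply (scaleC u g) y = complex_of_real (cmod z)"
        by (simp add: cdual_apply_scaleC_left z_def[symmetric] u(2))
      ultimately have near: "norm (F - scaleC u g) < e / 2"
        using d(2)[of "scaleC u g"] Re k(2) complex_Re_le_cmod[of z] by simp
      have z1: "cmod z \<le> 1"
        using norm_cdual_apply[of g y] g(1) y by (simp add: z_def)
      have Re_eq: "Re z = Re u * cmod z"
      proof -
        have "cnj u * u = 1" using u(1) complex_norm_square[of u] by (simp add: mult.commute)
        then have "z = cnj u * complex_of_real (cmod z)"
        by (metis u(2) mult.assoc mult_1)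
        then have "Re z = Re (cnj u * complex_of_real (cmod z))" by metis
        then show ?thesis by simp
      qed
      \<comment> \<open>\<open>Re z\<close> is positive and equals \<open>Re u\<close> times a
        modulus at most 1, so the phase is at least as close to 1 as \<open>Re z\<close>
        tells.\<close>
      have "Re z \<le> Re u"
      proof (rule ccontr)
        assume "\<not> ?thesis"
        moreover have "0 < Re z" using Re k(3) by simp
        moreover have "0 \<le> Re u"
          using Re_eq \<open>0 < Re z\<close> by (smt (verit) mult_nonpos_nonneg norm_ge_zero)
        ultimately show False using Re_eq z1 mult_left_le[of "cmod z" "Re u"] by simp
      qed
      then have "1 - Re u \<le> k" using Re by simp
      then have "(cmod (u - 1))\<^sup>2 \<le> 2 * k"
        using cmod_diff_1_le[of u] u(1) by simp
      also have "\<dots> \<le> (e / 2)\<^sup>2" using k(4) by (simp add: power2_eq_square)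
      finally have "cmod (u - 1) \<le> e / 2"
        using \<open>e > 0\<close> by (simp add: power2_le_iff_abs_le)
      have "scaleC u g - g = scaleC (u - 1) g"
        using scaleC_add_left[of "u - 1" 1 g] scaleC_of_real[of 1 g] by simp
      then have "norm (scaleC u g - g) \<le> e / 2"
        using \<open>cmod (u - 1) \<le> e / 2\<close> g(1) mult_left_le[of "norm g" "cmod (u - 1)"]
        by (simp add: norm_scaleC)
      then show ?thesis
        using near norm_triangle_ineq[of "F - scaleC u g" "scaleC u g - g"] by simp
    qed
    then show "\<exists>d>0. \<forall>g\<in>cball 0 1. 1 - d < Re (cdual_apply g y) \<longrightarrow> norm (F - g) < e"
      using k(1) by blast
  qed
qed

text \<open>The distance to 1 is at most \<open>sqrt (2 * (1 - Re (z n)))\<close>. This matches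
  complex convergence of the values with the real pairing.\<close>

lemma tendsto_1_iff_Re:
  assumes "\<And>n. cmod (z n) \<le> 1"
  shows "(z \<longlonglongrightarrow> 1) \<longleftrightarrow> (\<lambda>n. Re (z n)) \<longlonglongrightarrow> 1"
proof
  assume Re: "(\<lambda>n. Re (z n)) \<longlonglongrightarrow> 1"
  have "(\<lambda>n. sqrt (2 * (1 - Re (z n)))) \<longlonglongrightarrow> sqrt (2 * (1 - 1))"
    by (intro tendsto_intros Re)
  then have "(\<lambda>n. sqrt (2 * (1 - Re (z n)))) \<longlonglongrightarrow> 0" by simp
  then have "(\<lambda>n. z n - 1) \<longlonglongrightarrow> 0"
    by (rule Lim_null_comparison[rotated]) (intro always_eventually allI real_le_rsqrt cmod_diff_1_le assms)
  then show "z \<longlonglongrightarrow> 1" by (simp add: LIM_zero_iff)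
qed (use tendsto_Re in fastforce)

section \<open>Smoothness of the dual through maximizing sequences, for real and for complex
  scalars\<close>

theorem mainTheorem1:
  shows "(uniformly_smooth TYPE('a::banach \<Rightarrow>\<^sub>L real) \<longleftrightarrow>
      (\<forall>(x :: nat \<Rightarrow> 'a) (y :: nat \<Rightarrow> 'a) (a :: 'a \<Rightarrow>\<^sub>L real).
        (\<forall>n. x n \<in> sphere 0 1) \<longrightarrow> (\<forall>n. y n \<in> sphere 0 1) \<longrightarrow> a \<in> sphere 0 1 \<longrightarrow>
        (\<lambda>n. blinfun_apply a (x n)) \<longlonglongrightarrow> 1 \<longrightarrow>
        (\<lambda>n. blinfun_apply a (y n)) \<longlonglongrightarrow> 1 \<longrightarrow>
        (\<lambda>n. norm (x n - y n)) \<longlonglongrightarrow> 0))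
    \<and> (cuniformly_smooth TYPE('b::complex_banach cdual) \<longleftrightarrow>
      (\<forall>(x :: nat \<Rightarrow> 'b) (y :: nat \<Rightarrow> 'b) (a :: 'b cdual).
        (\<forall>n. x n \<in> sphere 0 1) \<longrightarrow> (\<forall>n. y n \<in> sphere 0 1) \<longrightarrow> a \<in> sphere 0 1 \<longrightarrow>
        (\<lambda>n. cdual_apply a (x n)) \<longlonglongrightarrow> 1 \<longrightarrow>
        (\<lambda>n. cdual_apply a (y n)) \<longlonglongrightarrow> 1 \<longrightarrow>
        (\<lambda>n. norm (x n - y n)) \<longlonglongrightarrow> 0))"
proof
  let ?b = "blinfun_apply :: ('a \<Rightarrow>\<^sub>L real) \<Rightarrow> 'a \<Rightarrow> real"
  let ?c = "blinfun_apply :: (('a \<Rightarrow>\<^sub>L real) \<Rightarrow>\<^sub>L real) \<Rightarrow> ('a \<Rightarrow>\<^sub>L real) \<Rightarrow> real"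
  obtain J :: "'a \<Rightarrow> ('a \<Rightarrow>\<^sub>L real) \<Rightarrow>\<^sub>L real"
    where J: "\<And>x f. blinfun_apply (J x) f = blinfun_apply f x"
    using blinfun_evaluation by metis
  have "bidual_pairing ?b ?c J"
    by (intro bidual_pairing.intro norming_pairing_blinfun bidual_pairing_axioms.intro
        norming_functional J)
  note iff = bidual_pairing.ex1_smooth_point_iff[OF this]
  have "uniformly_smooth TYPE('a \<Rightarrow>\<^sub>L real) \<longleftrightarrow>
      (\<forall>a. norm a = 1 \<longrightarrow> norming_pairing.maximizing_limits ?b a)"
    unfolding uniformly_smooth_def norming_pairing.smooth_point_def[OF norming_pairing_blinfun, symmetric]
    by (simp add: Ball_def iff cong: imp_cong)
  then show "uniformly_smooth TYPE('a \<Rightarrow>\<^sub>L real) \<longleftrightarrow>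
      (\<forall>(x :: nat \<Rightarrow> 'a) (y :: nat \<Rightarrow> 'a) (a :: 'a \<Rightarrow>\<^sub>L real).
        (\<forall>n. x n \<in> sphere 0 1) \<longrightarrow> (\<forall>n. y n \<in> sphere 0 1) \<longrightarrow> a \<in> sphere 0 1 \<longrightarrow>
        (\<lambda>n. blinfun_apply a (x n)) \<longlonglongrightarrow> 1 \<longrightarrow>
        (\<lambda>n. blinfun_apply a (y n)) \<longlonglongrightarrow> 1 \<longrightarrow>
        (\<lambda>n. norm (x n - y n)) \<longlonglongrightarrow> 0)"
    unfolding norming_pairing.maximizing_limits_def[OF norming_pairing_blinfun] mem_sphere_0
    by blast
next
  let ?b = "\<lambda>(f :: 'b cdual) x. Re (cdual_apply f x)"
  let ?c = "\<lambda>(F :: 'b cdual cdual) f. Re (cdual_apply F f)"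
  obtain J :: "'b \<Rightarrow> 'b cdual cdual" where J: "\<And>x f. cdual_apply (J x) f = cdual_apply f x"
    using cdual_evaluation by metis
  have "bidual_pairing ?b ?c J"
    by (intro bidual_pairing.intro norming_pairing_cdual bidual_pairing_axioms.intro norming_cdual)
      (simp add: J)
  then have iff: "(\<exists>!F. norm F = 1 \<and> norming_pairing.smooth_point ?c a F) \<longleftrightarrow>
      norming_pairing.maximizing_limits ?b a" if "norm a = 1" for a
    using that by (rule bidual_pairing.ex1_smooth_point_iff)
  \<comment> \<open>The tests on real values in the definition are exchanged for tests on real
    parts, the form in which the pairing result applies.\<close>
  have "cuniformly_smooth TYPE('b cdual) \<longleftrightarrow>
      (\<forall>a. norm a = 1 \<longrightarrow> (\<exists>!F. norm F = 1 \<and> norming_pairing.smooth_point ?c a F))"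
    unfolding cuniformly_smooth_def Ball_def[of "sphere 0 1"] mem_sphere_0
    by (simp only: cdual_smooth_point_iff cong: imp_cong)
  also have "\<dots> \<longleftrightarrow> (\<forall>a. norm a = 1 \<longrightarrow> norming_pairing.maximizing_limits ?b a)"
    by (simp only: iff cong: imp_cong)
  finally have smooth_iff: "cuniformly_smooth TYPE('b cdual) \<longleftrightarrow> \<dots>" .
  have to1: "(\<lambda>n. cdual_apply a (x n)) \<longlonglongrightarrow> 1 \<longleftrightarrow> (\<lambda>n. ?b a (x n)) \<longlonglongrightarrow> 1"
    if "norm a = 1" "\<forall>n. norm (x n) = 1" for a :: "'b cdual" and x
  proof (rule tendsto_1_iff_Re)
    show "cmod (cdual_apply a (x n)) \<le> 1" for n
      using norm_cdual_apply[of a "x n"] that by simp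
  qed
  show "cuniformly_smooth TYPE('b cdual) \<longleftrightarrow>
      (\<forall>(x :: nat \<Rightarrow> 'b) (y :: nat \<Rightarrow> 'b) (a :: 'b cdual).
        (\<forall>n. x n \<in> sphere 0 1) \<longrightarrow> (\<forall>n. y n \<in> sphere 0 1) \<longrightarrow> a \<in> sphere 0 1 \<longrightarrow>
        (\<lambda>n. cdual_apply a (x n)) \<longlonglongrightarrow> 1 \<longrightarrow>
        (\<lambda>n. cdual_apply a (y n)) \<longlonglongrightarrow> 1 \<longrightarrow>
        (\<lambda>n. norm (x n - y n)) \<longlonglongrightarrow> 0)"
    unfolding smooth_iff norming_pairing.maximizing_limits_def[OF norming_pairing_cdual] mem_sphere_0
    using to1 by meson
qed

end
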